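(* Let $J=\Delta_2^d$ with $d\ge2$ and let $t>0$. Set $$q_t(d):=t\cdot\min_{1\le k\le d-1}\log_2\left(\frac{(k+1)(d-k+1)}{k(d-k)}\right).$$ Then $\mathrm N_t\,\mathrm R_J^{\mathrm w}(\mathbb T_q)\subseteq\mathrm L_J$ for all $0<q\le q_t(d)$. Moreover, for $t=0$ this conclusion fails for every $q>0$: in that case $\mathrm R_J^{\mathrm w}(\mathbb T_q)\not\subseteq\mathrm L_J$ for every $q>0$. On the other hand, $\mathrm R_J^{\mathrm w}(\mathbb T_0)=\mathrm L_J$.
   Context: **Notation.** $\mathbb N=\{0,1,2,\dots\}$; $e_1,e_2$ are the standard basis vectors of $\mathbb N^2$; $\Delta_2^d=\{\alpha\in\mathbb N^2:\alpha_1+\alpha_2=d\}$; $\alpha!=\alpha_1!\alpha_2!$; inequalities between vectors are coordinatewise. Here $J=\Delta_2^d$, whose coordinatewise minimum is $(0,0)$ and maximum is $(d,d)$. The support of a polynomial or of a function on $\Delta_2^d$ is the set of $\alpha$ at which the coefficient (value) is nonzero. **Lorentzian polynomials.** A homogeneous polynomial $f$ of degree $d$ in $x_1,x_2$ with nonnegative real coefficients is strictly Lorentzian if for every $\alpha\in\Delta_2^{d-2}$ the Hessian of $\partial^\alpha f$ has exactly one positive and one negative eigenvalue. A Lorentzian polynomial is a limit of strictly Lorentzian polynomials. $\mathrm L_J$ is the set of Lorentzian polynomials with support $J$. **Weak representations.** For $q>0$, nonnegative reals $a,b,c$ satisfy the $\mathbb T_q$-relation if $a^{1/q},b^{1/q},c^{1/q}$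 are the side lengths of a (possibly degenerate) Euclidean triangle (each at most the sum of the other two); they satisfy the $\mathbb T_0$-relation if they satisfy the $\mathbb T_q$-relation for all $q>0$ (equivalently, all are zero or their maximum is attained at least twice). For $0\le q<\infty$, a weak $\mathbb T_q$-representation of $J=\Delta_2^d$ is a function $\rho:\Delta_2^d\to\mathbb R_{\ge0}$ with support $J$ such that for every $\alpha\in\Delta_2^{d-2}$ and $1\le i\le j\le k\le\ell\le2$ with $\alpha+e_i+e_j+e_k+e_\ell\le(d,d)$, the three numbers $\rho(\alpha+e_j+e_k)\rho(\alpha+e_i+e_\ell)$, $\rho(\alpha+e_i+e_k)\rho(\alpha+e_j+e_\ell)$, $\rho(\alpha+e_i+e_j)\rho(\alpha+e_k+e_\ell)$ satisfy the $\mathbb T_q$-relation. $\mathrm R_J^{\mathrm w}(\mathbb T_q)$ is the set of these, each $\rho$ being identified with $f_\rho=\sum_{\alpha\in J}\rho(\alpha)x^\alpha/\alpha!$. **Normalization operators.** For $t\ge0$, $\mathrm N_t$ is the linear operator on polynomials with $\mathrm N_t(x^\alpha)=x^\alpha/(\alpha!)^t$; $\mathrm N_0$ is the identity. *)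

theory Defs
  imports
    "HOL-Analysis.Analysis"
    "HOL-Library.Poly_Mapping"
    "HOL-Library.FuncSet"
    "HOL-Library.Product_Plus"
    "Jordan_Normal_Form.Char_Poly"
begin

text \<open>A multi-index $(\alpha_1,\alpha_2)$ is a pair of naturals with componentwise addition
  and subtraction; a polynomial in $x_1,x_2$ is the finitely supported function
  sending each exponent to its coefficient.\<close>

type_synonym midx = "nat \<times> nat"
type_synonym poly2 = "midx \<Rightarrow>\<^sub>0 real"

definition simplex2 :: "nat \<Rightarrow> midx set" where
  "simplex2 d = {\<alpha>. fst \<alpha> + snd \<alpha> = d}"

text \<open>Only the indices $1$ and $2$ are meaningful here.\<close>

definition unit_idx :: "nat \<Rightarrow> midx" where
  "unit_idx i = (if i = 1 then (1, 0) else (0, 1))"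

definition comp_idx :: "midx \<Rightarrow> nat \<Rightarrow> nat" where
  "comp_idx \<alpha> i = (if i = 1 then fst \<alpha> else snd \<alpha>)"

definition midx_fact :: "midx \<Rightarrow> real" where
  "midx_fact \<alpha> = fact (fst \<alpha>) * fact (snd \<alpha>)"

abbreviation coeff2 :: "poly2 \<Rightarrow> midx \<Rightarrow> real" where
  "coeff2 f \<alpha> \<equiv> Poly_Mapping.lookup f \<alpha>"

abbreviation supp2 :: "poly2 \<Rightarrow> midx set" where
  "supp2 f \<equiv> Poly_Mapping.keys f"

definition homogeneous2 :: "nat \<Rightarrow> poly2 \<Rightarrow> bool" where
  "homogeneous2 d f \<longleftrightarrow> supp2 f \<subseteq> simplex2 d"

definition eval2 :: "poly2 \<Rightarrow> real \<times> real \<Rightarrow> real" where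
  "eval2 f x = (\<Sum>\<beta>\<in>supp2 f. coeff2 f \<beta> * fst x ^ fst \<beta> * snd x ^ snd \<beta>)"

text \<open>The truncated subtraction for $\beta_i = 0$ is harmless: the coefficient $\beta_i$ vanishes.\<close>

definition pderiv2 :: "nat \<Rightarrow> poly2 \<Rightarrow> poly2" where
  "pderiv2 i f =
     (\<Sum>\<beta>\<in>supp2 f. Poly_Mapping.single (\<beta> - unit_idx i) (real (comp_idx \<beta> i) * coeff2 f \<beta>))"

definition midx_pderiv2 :: "midx \<Rightarrow> poly2 \<Rightarrow> poly2" where
  "midx_pderiv2 \<alpha> f = (pderiv2 1 ^^ fst \<alpha>) ((pderiv2 2 ^^ snd \<alpha>) f)"

text \<open>The rows and columns of a \<open>mat\<close> are numbered from $0$.\<close>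

definition hessian2 :: "poly2 \<Rightarrow> real \<times> real \<Rightarrow> real mat" where
  "hessian2 f x = mat 2 2 (\<lambda>(i, j). eval2 (pderiv2 (i + 1) (pderiv2 (j + 1) f)) x)"

text \<open>A $2\times 2$ matrix has at most two eigenvalues with multiplicity, so if it has a
  positive and a negative one, both are simple. For $|\alpha| = d - 2$ the Hessian of
  $\partial^\alpha f$ does not depend on the point $x$.\<close>

definition strictly_lorentzian2 :: "nat \<Rightarrow> poly2 \<Rightarrow> bool" where
  "strictly_lorentzian2 d f \<longleftrightarrow>
     homogeneous2 d f \<and> (\<forall>\<alpha>. coeff2 f \<alpha> \<ge> 0) \<and>
     (\<forall>\<alpha>. fst \<alpha> + snd \<alpha> + 2 = d \<longrightarrow>
        (\<forall>x. (\<exists>!e. eigenvalue (hessian2 (midx_pderiv2 \<alpha> f) x) e \<and> e > 0) \<and>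
             (\<exists>!e. eigenvalue (hessian2 (midx_pderiv2 \<alpha> f) x) e \<and> e < 0)))"

text \<open>Limits are taken in the finite-dimensional space of forms of degree $d$, that is,
  coefficientwise.\<close>

definition lorentzian2 :: "nat \<Rightarrow> poly2 \<Rightarrow> bool" where
  "lorentzian2 d f \<longleftrightarrow>
     (\<exists>g. (\<forall>n. strictly_lorentzian2 d (g n)) \<and>
          (\<forall>\<alpha>. (\<lambda>n::nat. coeff2 (g n) \<alpha>) \<longlonglongrightarrow> coeff2 f \<alpha>))"

definition L_J :: "nat \<Rightarrow> poly2 set" where
  "L_J d = {f. lorentzian2 d f \<and> supp2 f = simplex2 d}"

definition triangle_rel :: "real \<Rightarrow> real \<Rightarrow> real \<Rightarrow> real \<Rightarrow> bool" where
  "triangle_rel q a b c \<longleftrightarrow>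
     a powr (1 / q) \<le> b powr (1 / q) + c powr (1 / q) \<and>
     b powr (1 / q) \<le> a powr (1 / q) + c powr (1 / q) \<and>
     c powr (1 / q) \<le> a powr (1 / q) + b powr (1 / q)"

definition T_rel :: "real \<Rightarrow> real \<Rightarrow> real \<Rightarrow> real \<Rightarrow> bool" where
  "T_rel q a b c \<longleftrightarrow>
     (if q = 0 then \<forall>p>0. triangle_rel p a b c else triangle_rel q a b c)"

definition weak_rep :: "nat \<Rightarrow> real \<Rightarrow> (midx \<Rightarrow> real) set" where
  "weak_rep d q =
     {\<rho> \<in> simplex2 d \<rightarrow>\<^sub>E {0..}.
        {\<alpha> \<in> simplex2 d. \<rho> \<alpha> \<noteq> 0} = simplex2 d \<and>
        (\<forall>\<alpha> i j k l.
           fst \<alpha> + snd \<alpha> + 2 = d \<longrightarrow> 1 \<le> i \<longrightarrow> i \<le> j \<longrightarrow> j \<le> k \<longrightarrow> k \<le> l \<longrightarrow> l \<le> 2 \<longrightarrow>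
           fst (\<alpha> + unit_idx i + unit_idx j + unit_idx k + unit_idx l) \<le> d \<longrightarrow>
           snd (\<alpha> + unit_idx i + unit_idx j + unit_idx k + unit_idx l) \<le> d \<longrightarrow>
           T_rel q
             (\<rho> (\<alpha> + unit_idx j + unit_idx k) * \<rho> (\<alpha> + unit_idx i + unit_idx l))
             (\<rho> (\<alpha> + unit_idx i + unit_idx k) * \<rho> (\<alpha> + unit_idx j + unit_idx l))
             (\<rho> (\<alpha> + unit_idx i + unit_idx j) * \<rho> (\<alpha> + unit_idx k + unit_idx l)))}"

definition rep_poly :: "nat \<Rightarrow> (midx \<Rightarrow> real) \<Rightarrow> poly2" where
  "rep_poly d \<rho> = (\<Sum>\<alpha>\<in>simplex2 d. Poly_Mapping.single \<alpha> (\<rho> \<alpha> / midx_fact \<alpha>))"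

definition R_J_w :: "nat \<Rightarrow> real \<Rightarrow> poly2 set" where
  "R_J_w d q = rep_poly d ` weak_rep d q"

definition norm_op :: "real \<Rightarrow> poly2 \<Rightarrow> poly2" where
  "norm_op t f = (\<Sum>\<alpha>\<in>supp2 f. Poly_Mapping.single \<alpha> (coeff2 f \<alpha> / midx_fact \<alpha> powr t))"

definition q_bound :: "real \<Rightarrow> nat \<Rightarrow> real" where
  "q_bound t d =
     t * Min ((\<lambda>k. log 2 ((real k + 1) * (real d - real k + 1) / (real k * (real d - real k))))
                ` {1..d - 1})"

lemma lookup_norm_op: "coeff2 (norm_op t f) \<alpha> = coeff2 f \<alpha> / midx_fact \<alpha> powr t"
  by (simp add: norm_op_def Poly_Mapping.lookup_sum Poly_Mapping.lookup_single when_def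
      sum.delta in_keys_iff)

lemma norm_op_0: "norm_op 0 f = f"
proof -
  have "midx_fact \<alpha> \<noteq> 0" for \<alpha>
    by (simp add: midx_fact_def)
  then show ?thesis
    by (intro poly_mapping_eqI) (simp add: lookup_norm_op)
qed

end

theory Submission
  imports Defs
begin

text \<open>
  A binary form is governed by its exponential coefficients \<open>\<alpha>! c\<^sub>\<alpha>\<close>, because partial
  derivatives act on them as shifts.  For a form of degree \<open>d\<close>, let \<open>a\<^sub>k\<close> be the one with
  \<open>\<alpha> = (k, d - k)\<close>; the Hessians in the definition of a strictly Lorentzian form are the matrices
  with rows \<open>(a\<^bsub>k+1\<^esub>, a\<^sub>k)\<close> and \<open>(a\<^sub>k, a\<^bsub>k-1\<^esub>)\<close> for \<open>0 < k < d\<close>.  A symmetric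
  \<open>2 \<times> 2\<close> matrix with nonnegative diagonal has one positive and one negative eigenvalue iff its
  determinant is negative, so strictly Lorentzian means \<open>a\<^bsub>k-1\<^esub> a\<^bsub>k+1\<^esub> < a\<^sub>k\<^sup>2\<close>.
  Multiplying \<open>a\<^sub>k\<close> by \<open>\<theta>\<close> to the power \<open>k\<^sup>2\<close>, with \<open>\<theta> < 1\<close> and \<open>\<theta> \<rightarrow> 1\<close>, turns the weak
  inequalities into strict ones; hence a form with full support is Lorentzian iff all \<open>a\<^sub>k\<close> are
  positive and \<open>a\<^bsub>k-1\<^esub> a\<^bsub>k+1\<^esub> \<le> a\<^sub>k\<^sup>2\<close> (\<open>mem_L_J_iff\<close>).

  On the other side, the only triangle relation with content is the one for the
  indices \<open>1, 1, 2, 2\<close>, whose entries are \<open>a\<^sub>k\<^sup>2\<close>, \<open>a\<^sub>k\<^sup>2\<close> and \<open>a\<^bsub>k-1\<^esub> a\<^bsub>k+1\<^esub>\<close>.  It says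
  \<open>a\<^bsub>k-1\<^esub> a\<^bsub>k+1\<^esub> \<le> 2\<^sup>q a\<^sub>k\<^sup>2\<close>, also for \<open>q = 0\<close> (\<open>mem_weak_rep_iff\<close>).  The three
  claims follow: for \<open>q = 0\<close> the two conditions agree; the sequence with
  \<open>a\<^sub>k = 2 powr (q k\<^sup>2 / 2)\<close> attains equality in the second one and so violates the first when
  \<open>q > 0\<close>; and normalization divides \<open>a\<^bsub>k-1\<^esub> a\<^bsub>k+1\<^esub> / a\<^sub>k\<^sup>2\<close> by the \<open>t\<close>-th power of
  \<open>(k+1)(d-k+1) / (k(d-k))\<close>, and this power is at least \<open>2\<^sup>q\<close> whenever \<open>q \<le> q_bound t d\<close>.
\<close>

section \<open>Exponential coefficients\<close>

text \<open>The coefficient of \<open>f\<close> with respect to the divided monomial \<open>x\<^sup>\<alpha> / \<alpha>!\<close>.\<close>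

definition exp_coeff :: "poly2 \<Rightarrow> midx \<Rightarrow> real" where
  "exp_coeff f \<alpha> = midx_fact \<alpha> * coeff2 f \<alpha>"

lemma midx_fact_pos: "midx_fact \<alpha> > 0"
  by (simp add: midx_fact_def)

lemma mem_simplex2 [simp]: "(m, n) \<in> simplex2 d \<longleftrightarrow> m + n = d"
  by (simp add: simplex2_def)

lemma finite_simplex2: "finite (simplex2 d)"
proof (rule finite_subset)
  show "simplex2 d \<subseteq> {..d} \<times> {..d}"
    by (auto simp: simplex2_def)
qed simp

lemma coeff2_pderiv2: "coeff2 (pderiv2 i f) \<gamma> = (real (comp_idx \<gamma> i) + 1) * coeff2 f (\<gamma> + unit_idx i)"
proof -
  have shift: "real (comp_idx \<beta> i) * coeff2 f \<beta> * of_bool (\<beta> - unit_idx i = \<gamma>) =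
      (if \<beta> = \<gamma> + unit_idx i then (real (comp_idx \<gamma> i) + 1) * coeff2 f \<beta> else 0)" for \<beta>
    by (cases \<beta>; cases \<gamma>) (auto simp: comp_idx_def unit_idx_def)
  have "coeff2 (pderiv2 i f) \<gamma> =
      (\<Sum>\<beta>\<in>supp2 f. real (comp_idx \<beta> i) * coeff2 f \<beta> * of_bool (\<beta> - unit_idx i = \<gamma>))"
    unfolding pderiv2_def Poly_Mapping.lookup_sum
    by (intro sum.cong refl) (auto simp: Poly_Mapping.lookup_single when_def)
  also have "\<dots> = (\<Sum>\<beta>\<in>supp2 f. if \<beta> = \<gamma> + unit_idx i
      then (real (comp_idx \<gamma> i) + 1) * coeff2 f \<beta> else 0)"
    by (simp only: shift)
  also have "\<dots> = (real (comp_idx \<gamma> i) + 1) * coeff2 f (\<gamma> + unit_idx i)"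
    by (simp add: in_keys_iff)
  finally show ?thesis .
qed

lemma exp_coeff_pderiv2: "exp_coeff (pderiv2 i f) \<gamma> = exp_coeff f (\<gamma> + unit_idx i)"
  by (cases \<gamma>) (auto simp: exp_coeff_def coeff2_pderiv2 midx_fact_def comp_idx_def unit_idx_def
      algebra_simps)

lemma exp_coeff_pderiv2_1_iter: "exp_coeff ((pderiv2 1 ^^ m) f) \<gamma> = exp_coeff f (\<gamma> + (m, 0))"
  by (induction m arbitrary: \<gamma>)
    (auto simp: exp_coeff_pderiv2 unit_idx_def add.assoc zero_prod_def[symmetric])

lemma exp_coeff_pderiv2_2_iter: "exp_coeff ((pderiv2 2 ^^ n) f) \<gamma> = exp_coeff f (\<gamma> + (0, n))"
  by (induction n arbitrary: \<gamma>)
    (auto simp: exp_coeff_pderiv2 unit_idx_def add.assoc zero_prod_def[symmetric])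

lemma exp_coeff_midx_pderiv2: "exp_coeff (midx_pderiv2 \<alpha> f) \<gamma> = exp_coeff f (\<gamma> + \<alpha>)"
  by (cases \<alpha>) (simp add: midx_pderiv2_def exp_coeff_pderiv2_1_iter[simplified]
      exp_coeff_pderiv2_2_iter add.assoc)

lemma exp_coeff_eq_0:
  assumes "homogeneous2 d f" and "fst \<alpha> + snd \<alpha> \<noteq> d"
  shows "exp_coeff f \<alpha> = 0"
  using assms by (auto simp: exp_coeff_def homogeneous2_def simplex2_def in_keys_iff)

lemma coeff2_rep_poly:
  "coeff2 (rep_poly d \<rho>) \<alpha> = (if \<alpha> \<in> simplex2 d then \<rho> \<alpha> / midx_fact \<alpha> else 0)"
proof -
  have "coeff2 (rep_poly d \<rho>) \<alpha> =
      (\<Sum>\<beta>\<in>simplex2 d. if \<beta> = \<alpha> then \<rho> \<beta> / midx_fact \<beta> else 0)"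
    unfolding rep_poly_def Poly_Mapping.lookup_sum
    by (intro sum.cong refl) (auto simp: Poly_Mapping.lookup_single when_def)
  then show ?thesis
    by (simp add: finite_simplex2)
qed

lemma exp_coeff_rep_poly: "exp_coeff (rep_poly d \<rho>) \<alpha> = (if \<alpha> \<in> simplex2 d then \<rho> \<alpha> else 0)"
  using midx_fact_pos[of \<alpha>] by (auto simp: exp_coeff_def coeff2_rep_poly)

lemma homogeneous2_rep_poly: "homogeneous2 d (rep_poly d \<rho>)"
  by (auto simp: homogeneous2_def in_keys_iff coeff2_rep_poly split: if_splits)

lemma supp2_rep_poly:
  assumes "\<And>\<alpha>. \<alpha> \<in> simplex2 d \<Longrightarrow> \<rho> \<alpha> > 0"
  shows "supp2 (rep_poly d \<rho>) = simplex2 d"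
proof -
  have "coeff2 (rep_poly d \<rho>) \<alpha> \<noteq> 0 \<longleftrightarrow> \<alpha> \<in> simplex2 d" for \<alpha>
    using assms[of \<alpha>] midx_fact_pos[of \<alpha>] by (auto simp: coeff2_rep_poly)
  then show ?thesis
    by (auto simp: in_keys_iff)
qed

section \<open>Lorentzian binary forms and log-concavity\<close>

lemma eigenvalue_2x2_iff:
  fixes a b c :: real
  assumes "A = mat 2 2 (\<lambda>(i, j). if i = 0 \<and> j = 0 then a else if i = 1 \<and> j = 1 then c else b)"
  shows "eigenvalue A e \<longleftrightarrow> (a - e) * (c - e) = b\<^sup>2"
proof -
  have "A \<in> carrier_mat 2 2"
    by (simp add: assms)
  then have "eigenvalue A e \<longleftrightarrow> det (char_matrix A e) = 0"
    by (rule eigenvalue_det)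
  also have "det (char_matrix A e) = (a - e) * (c - e) - b\<^sup>2"
    by (subst laplace_expansion_column[of _ 2 0])
      (simp_all add: char_matrix_def assms cofactor_def mat_delete_def det_single numeral_2_eq_2
        power2_eq_square algebra_simps)
  finally show ?thesis
    by auto
qed

lemma eigenvalue_signs_2x2_iff:
  fixes a b c :: real
  assumes "a \<ge> 0" and "c \<ge> 0"
    and ev: "\<And>e. eigenvalue A e \<longleftrightarrow> (a - e) * (c - e) = b\<^sup>2"
  shows "(\<exists>!e. eigenvalue A e \<and> e > 0) \<and> (\<exists>!e. eigenvalue A e \<and> e < 0) \<longleftrightarrow> a * c < b\<^sup>2"
proof
  assume "(\<exists>!e. eigenvalue A e \<and> e > 0) \<and> (\<exists>!e. eigenvalue A e \<and> e < 0)"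
  then obtain e where e: "(a - e) * (c - e) = b\<^sup>2" "e < 0"
    using ev by blast
  have "a * (- e) \<ge> 0" "c * (- e) \<ge> 0" "e * e > 0"
    using assms e by (auto intro: mult_nonneg_nonpos mult_neg_neg)
  with e(1) show "a * c < b\<^sup>2"
    by (simp add: algebra_simps)
next
  assume neg_det: "a * c < b\<^sup>2"
  define s where "s = sqrt ((a - c)\<^sup>2 + 4 * b\<^sup>2)"
  have s2: "s\<^sup>2 = (a - c)\<^sup>2 + 4 * b\<^sup>2"
    by (simp add: s_def)
  have "(a + c)\<^sup>2 < (a - c)\<^sup>2 + 4 * b\<^sup>2"
    using neg_det by (simp add: power2_eq_square algebra_simps)
  then have s: "a + c < s"
    unfolding s_def by (rule real_less_rsqrt)
  \<comment> \<open>The two roots of the characteristic polynomial; \<open>s\<^sup>2\<close> is its discriminant.\<close>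
  have roots: "eigenvalue A e \<longleftrightarrow> e = (a + c + s) / 2 \<or> e = (a + c - s) / 2" for e
  proof -
    have "(a - e) * (c - e) - b\<^sup>2 = (e - (a + c + s) / 2) * (e - (a + c - s) / 2)"
      using s2 by (simp add: power2_eq_square field_simps)
    then show ?thesis
      unfolding ev by (metis eq_iff_diff_eq_0 mult_eq_0_iff)
  qed
  have "(a + c + s) / 2 > 0" "(a + c - s) / 2 < 0"
    using s assms by auto
  then show "(\<exists>!e. eigenvalue A e \<and> e > 0) \<and> (\<exists>!e. eigenvalue A e \<and> e < 0)"
    unfolding roots by (smt (verit))
qed

lemma hessian2_midx_pderiv2:
  assumes "homogeneous2 d f" and "m + n + 2 = d"
  shows "hessian2 (midx_pderiv2 (m, n) f) x =
    mat 2 2 (\<lambda>(i, j). if i = 0 \<and> j = 0 then exp_coeff f (m + 2, n)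
      else if i = 1 \<and> j = 1 then exp_coeff f (m, n + 2) else exp_coeff f (m + 1, n + 1))"
proof -
  have entry: "eval2 (pderiv2 i (pderiv2 j (midx_pderiv2 (m, n) f))) x =
      exp_coeff f (unit_idx i + unit_idx j + (m, n))" for i j
  proof -
    define g where "g = pderiv2 i (pderiv2 j (midx_pderiv2 (m, n) f))"
    have g: "exp_coeff g \<gamma> = exp_coeff f (\<gamma> + unit_idx i + unit_idx j + (m, n))" for \<gamma>
      by (simp add: g_def exp_coeff_pderiv2 exp_coeff_midx_pderiv2 add.assoc)
    \<comment> \<open>By homogeneity \<open>g\<close> is constant.\<close>
    have "exp_coeff g \<gamma> = 0" if "\<gamma> \<noteq> 0" for \<gamma>
      unfolding g using that assms
      by (intro exp_coeff_eq_0[where d = d])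
        (auto simp: unit_idx_def zero_prod_def prod_eq_iff)
    then have supp: "supp2 g \<subseteq> {0}"
      using midx_fact_pos by (auto simp: exp_coeff_def in_keys_iff) (metis less_irrefl)
    have "eval2 g x = (\<Sum>\<beta>\<in>{0}. coeff2 g \<beta> * fst x ^ fst \<beta> * snd x ^ snd \<beta>)"
      unfolding eval2_def
      by (rule sum.mono_neutral_left) (use supp in \<open>auto simp: in_keys_iff\<close>)
    also have "\<dots> = exp_coeff g 0"
      by (simp add: exp_coeff_def midx_fact_def)
    also have "\<dots> = exp_coeff f (unit_idx i + unit_idx j + (m, n))"
      by (simp add: g)
    finally show ?thesis
      by (simp add: g_def)
  qed
  show ?thesis
    unfolding hessian2_def entry by (rule eq_matI) (auto simp: unit_idx_def less_2_cases_iff)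
qed

lemma strictly_lorentzian2_iff:
  "strictly_lorentzian2 d f \<longleftrightarrow>
     homogeneous2 d f \<and> (\<forall>\<alpha>. coeff2 f \<alpha> \<ge> 0) \<and>
     (\<forall>m n. m + n + 2 = d \<longrightarrow>
        exp_coeff f (m + 2, n) * exp_coeff f (m, n + 2) < (exp_coeff f (m + 1, n + 1))\<^sup>2)"
proof -
  have "(\<exists>!e. eigenvalue (hessian2 (midx_pderiv2 (m, n) f) x) e \<and> e > 0) \<and>
        (\<exists>!e. eigenvalue (hessian2 (midx_pderiv2 (m, n) f) x) e \<and> e < 0) \<longleftrightarrow>
      exp_coeff f (m + 2, n) * exp_coeff f (m, n + 2) < (exp_coeff f (m + 1, n + 1))\<^sup>2"
    if "homogeneous2 d f" "\<forall>\<alpha>. coeff2 f \<alpha> \<ge> 0" "m + n + 2 = d" for m n x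
  proof (rule eigenvalue_signs_2x2_iff)
    show "exp_coeff f (m + 2, n) \<ge> 0" "exp_coeff f (m, n + 2) \<ge> 0"
      using that(2) midx_fact_pos by (auto simp: exp_coeff_def less_imp_le)
  next
    fix e
    show "eigenvalue (hessian2 (midx_pderiv2 (m, n) f) x) e \<longleftrightarrow>
        (exp_coeff f (m + 2, n) - e) * (exp_coeff f (m, n + 2) - e) = (exp_coeff f (m + 1, n + 1))\<^sup>2"
      by (rule eigenvalue_2x2_iff[OF hessian2_midx_pderiv2[OF that(1,3)]])
  qed
  then show ?thesis
    unfolding strictly_lorentzian2_def by (simp cong: conj_cong)
qed

lemma mem_L_J_iff:
  "f \<in> L_J d \<longleftrightarrow>
     supp2 f = simplex2 d \<and> (\<forall>\<alpha>\<in>simplex2 d. exp_coeff f \<alpha> > 0) \<and>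
     (\<forall>m n. m + n + 2 = d \<longrightarrow>
        exp_coeff f (m + 2, n) * exp_coeff f (m, n + 2) \<le> (exp_coeff f (m + 1, n + 1))\<^sup>2)"
    (is "_ \<longleftrightarrow> ?supp \<and> ?pos \<and> ?conc")
proof
  assume "f \<in> L_J d"
  then obtain g where supp: ?supp and g: "\<And>k. strictly_lorentzian2 d (g k)"
    and lim: "\<And>\<alpha>. (\<lambda>k. coeff2 (g k) \<alpha>) \<longlonglongrightarrow> coeff2 f \<alpha>"
    by (auto simp: L_J_def lorentzian2_def)
  have lim_exp: "(\<lambda>k. exp_coeff (g k) \<alpha>) \<longlonglongrightarrow> exp_coeff f \<alpha>" for \<alpha>
    unfolding exp_coeff_def by (intro tendsto_intros lim)
  have ?pos
  proof
    fix \<alpha> assume "\<alpha> \<in> simplex2 d"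
    then have "coeff2 f \<alpha> \<noteq> 0"
      using supp by (auto simp: in_keys_iff)
    moreover have "coeff2 f \<alpha> \<ge> 0"
      by (rule LIMSEQ_le_const[OF lim]) (meson g strictly_lorentzian2_def)
    ultimately show "exp_coeff f \<alpha> > 0"
      using midx_fact_pos[of \<alpha>] by (simp add: exp_coeff_def)
  qed
  moreover have ?conc
  proof (intro allI impI)
    fix m n assume d: "m + n + 2 = d"
    have "exp_coeff (g k) (m + 2, n) * exp_coeff (g k) (m, n + 2)
        \<le> (exp_coeff (g k) (m + 1, n + 1))\<^sup>2" for k
      using g[of k] d unfolding strictly_lorentzian2_iff by (blast intro: less_imp_le)
    then have "\<exists>N. \<forall>k\<ge>N. exp_coeff (g k) (m + 2, n) * exp_coeff (g k) (m, n + 2)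
        \<le> (exp_coeff (g k) (m + 1, n + 1))\<^sup>2"
      by blast
    then show "exp_coeff f (m + 2, n) * exp_coeff f (m, n + 2) \<le> (exp_coeff f (m + 1, n + 1))\<^sup>2"
      by (rule LIMSEQ_le[rotated 2]) (intro tendsto_intros lim_exp)+
  qed
  ultimately show "?supp \<and> ?pos \<and> ?conc"
    using supp by blast
next
  assume R: "?supp \<and> ?pos \<and> ?conc"
  define \<theta> where "\<theta> k = 1 - inverse (real (Suc (Suc k)))" for k
  have \<theta>: "0 < \<theta> k" "\<theta> k < 1" for k
    by (simp_all add: \<theta>_def field_simps)
  have lim_\<theta>: "\<theta> \<longlonglongrightarrow> 1"
    using tendsto_diff[OF tendsto_const LIMSEQ_Suc[OF LIMSEQ_inverse_real_of_nat], of 1]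
    by (simp add: \<theta>_def[abs_def])
  define g where "g k = rep_poly d (\<lambda>\<alpha>. \<theta> k ^ ((fst \<alpha>)\<^sup>2) * exp_coeff f \<alpha>)" for k
  have "strictly_lorentzian2 d (g k)" for k
    unfolding strictly_lorentzian2_iff
  proof (intro conjI allI impI)
    show "homogeneous2 d (g k)"
      by (simp add: g_def homogeneous2_rep_poly)
  next
    fix \<alpha>
    show "coeff2 (g k) \<alpha> \<ge> 0"
      using R \<theta>[of k] midx_fact_pos[of \<alpha>] by (auto simp: g_def coeff2_rep_poly less_imp_le)
  next
    fix m n assume d: "m + n + 2 = d"
    define a b c u where "a = exp_coeff f (m + 2, n)" and "b = exp_coeff f (m + 1, n + 1)"
      and "c = exp_coeff f (m, n + 2)" and "u = \<theta> k ^ ((m + 1)\<^sup>2)"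
    have ac: "a > 0" "c > 0" "a * c \<le> b\<^sup>2"
      using R d by (auto simp: a_def b_def c_def)
    have "(m + 2)\<^sup>2 + m\<^sup>2 = 2 + ((m + 1)\<^sup>2 + (m + 1)\<^sup>2)"
      by (simp add: power2_eq_square)
    then have "\<theta> k ^ ((m + 2)\<^sup>2) * \<theta> k ^ (m\<^sup>2) = (\<theta> k)\<^sup>2 * u\<^sup>2"
      unfolding u_def by (metis power_add power2_eq_square)
    then have "\<theta> k ^ ((m + 2)\<^sup>2) * a * (\<theta> k ^ (m\<^sup>2) * c) = (\<theta> k)\<^sup>2 * (u\<^sup>2 * (a * c))"
      by (metis mult.assoc mult.left_commute)
    also have "\<dots> < 1 * (u\<^sup>2 * (a * c))"
      using \<theta>[of k] ac by (intro mult_strict_right_mono) (auto simp: u_def power_less_one_iff)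
    also have "\<dots> \<le> (u * b)\<^sup>2"
      using ac by (simp add: power_mult_distrib mult_left_mono)
    finally show "exp_coeff (g k) (m + 2, n) * exp_coeff (g k) (m, n + 2)
        < (exp_coeff (g k) (m + 1, n + 1))\<^sup>2"
      using d by (simp add: g_def exp_coeff_rep_poly a_def b_def c_def u_def)
  qed
  moreover have "(\<lambda>k. coeff2 (g k) \<alpha>) \<longlonglongrightarrow> coeff2 f \<alpha>" for \<alpha>
  proof (cases "\<alpha> \<in> simplex2 d")
    case True
    have "(\<lambda>k. \<theta> k ^ ((fst \<alpha>)\<^sup>2) * coeff2 f \<alpha>) \<longlonglongrightarrow> 1 ^ ((fst \<alpha>)\<^sup>2) * coeff2 f \<alpha>"
      by (intro tendsto_intros lim_\<theta>)
    then show ?thesis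
      using True midx_fact_pos[of \<alpha>] by (simp add: g_def coeff2_rep_poly exp_coeff_def)
  next
    case False
    then have "coeff2 f \<alpha> = 0"
      using R by (auto simp: in_keys_iff)
    then show ?thesis
      using False by (simp add: g_def coeff2_rep_poly)
  qed
  ultimately show "f \<in> L_J d"
    using R by (auto simp: L_J_def lorentzian2_def)
qed

section \<open>Weak representations as approximate log-concavity\<close>

lemma triangle_rel_isosceles_iff:
  assumes "q > 0" and "x > 0" and "y > 0"
  shows "triangle_rel q x x y \<longleftrightarrow> y \<le> 2 powr q * x"
proof -
  have "triangle_rel q x x y \<longleftrightarrow> y powr (1 / q) \<le> 2 * x powr (1 / q)"
    by (auto simp: triangle_rel_def)
  also have "2 * x powr (1 / q) = (2 powr q * x) powr (1 / q)"
    using assms by (simp add: powr_mult powr_powr)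
  also have "y powr (1 / q) \<le> \<dots> \<longleftrightarrow> y \<le> 2 powr q * x"
    using assms powr_less_mono2[of "1 / q" "2 powr q * x" y] powr_mono2[of "1 / q" y "2 powr q * x"]
    by (auto simp: not_le[symmetric])
  finally show ?thesis .
qed

lemma T_rel_isosceles_iff:
  assumes "q \<ge> 0" and "x > 0" and "y > 0"
  shows "T_rel q x x y \<longleftrightarrow> y \<le> 2 powr q * x"
proof (cases "q = 0")
  case True
  have "(\<forall>p>0. y \<le> 2 powr p * x) \<longleftrightarrow> y \<le> x"
  proof
    assume le: "\<forall>p>0. y \<le> 2 powr p * x"
    have "((\<lambda>p. 2 powr p * x) \<longlongrightarrow> 2 powr 0 * x) (at_right 0)"
      by (intro tendsto_intros) auto
    then have "y \<le> 2 powr 0 * x"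
      by (rule tendsto_lowerbound)
        (use le in \<open>auto simp: eventually_at_filter\<close>)
    then show "y \<le> x"
      by simp
  next
    assume "y \<le> x"
    moreover have "1 * x \<le> 2 powr p * x" if "p > 0" for p
      using that assms by (intro mult_right_mono ge_one_powr_ge_zero) auto
    ultimately show "\<forall>p>0. y \<le> 2 powr p * x"
      by fastforce
  qed
  then show ?thesis
    using True assms by (simp add: T_rel_def triangle_rel_isosceles_iff)
next
  case False
  then show ?thesis
    using assms by (simp add: T_rel_def triangle_rel_isosceles_iff)
qed

lemma T_rel_refl: "T_rel q x x x"
  by (auto simp: T_rel_def triangle_rel_def)

lemma mem_weak_rep_iff:
  assumes "q \<ge> 0"
  shows "\<rho> \<in> weak_rep d q \<longleftrightarrow>
    \<rho> \<in> extensional (simplex2 d) \<and> (\<forall>\<alpha>\<in>simplex2 d. \<rho> \<alpha> > 0) \<and>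
    (\<forall>m n. m + n + 2 = d \<longrightarrow> \<rho> (m + 2, n) * \<rho> (m, n + 2) \<le> 2 powr q * (\<rho> (m + 1, n + 1))\<^sup>2)"
    (is "_ \<longleftrightarrow> ?ext \<and> ?pos \<and> ?conc")
proof -
  define T where "T \<alpha> i j k l \<longleftrightarrow> T_rel q
      (\<rho> (\<alpha> + unit_idx j + unit_idx k) * \<rho> (\<alpha> + unit_idx i + unit_idx l))
      (\<rho> (\<alpha> + unit_idx i + unit_idx k) * \<rho> (\<alpha> + unit_idx j + unit_idx l))
      (\<rho> (\<alpha> + unit_idx i + unit_idx j) * \<rho> (\<alpha> + unit_idx k + unit_idx l))" for \<alpha> i j k l
  define D where "D \<alpha> i j k l \<longleftrightarrow>
      fst (\<alpha> + unit_idx i + unit_idx j + unit_idx k + unit_idx l) \<le> d \<and>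
      snd (\<alpha> + unit_idx i + unit_idx j + unit_idx k + unit_idx l) \<le> d" for \<alpha> i j k l
  have def: "\<rho> \<in> weak_rep d q \<longleftrightarrow> ?ext \<and> ?pos \<and>
      (\<forall>\<alpha> i j k l. fst \<alpha> + snd \<alpha> + 2 = d \<longrightarrow> 1 \<le> i \<longrightarrow> i \<le> j \<longrightarrow> j \<le> k \<longrightarrow> k \<le> l \<longrightarrow> l \<le> 2 \<longrightarrow>
         D \<alpha> i j k l \<longrightarrow> T \<alpha> i j k l)"
    unfolding weak_rep_def T_def D_def
    by (auto simp: PiE_def Pi_def order.strict_iff_order)
  have T1122: "T (m, n) 1 1 2 2 \<longleftrightarrow>
      \<rho> (m + 2, n) * \<rho> (m, n + 2) \<le> 2 powr q * (\<rho> (m + 1, n + 1))\<^sup>2"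
    if "m + n + 2 = d" ?pos for m n
  proof -
    have "T (m, n) 1 1 2 2 \<longleftrightarrow> T_rel q ((\<rho> (m + 1, n + 1))\<^sup>2) ((\<rho> (m + 1, n + 1))\<^sup>2)
        (\<rho> (m + 2, n) * \<rho> (m, n + 2))"
      by (simp add: T_def unit_idx_def power2_eq_square)
    also have "\<dots> \<longleftrightarrow> \<rho> (m + 2, n) * \<rho> (m, n + 2) \<le> 2 powr q * (\<rho> (m + 1, n + 1))\<^sup>2"
    proof (rule T_rel_isosceles_iff)
      have "\<rho> (m + 1, n + 1) > 0"
        using that by simp
      then show "(\<rho> (m + 1, n + 1))\<^sup>2 > 0"
        by (rule zero_less_power)
    qed (use that assms in auto)
    finally show ?thesis .
  qed
  \<comment> \<open>For the other choices of indices the three products coincide.\<close>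
  have T: "T \<alpha> i j k l"
    if "1 \<le> i" "i \<le> j" "j \<le> k" "k \<le> l" "l \<le> 2" "\<not> (i = 1 \<and> j = 1 \<and> k = 2 \<and> l = 2)" for \<alpha> i j k l
  proof -
    have "i = j \<and> j = k \<or> j = k \<and> k = l"
      using that by linarith
    then show ?thesis
      by (auto simp: T_def T_rel_refl mult.commute)
  qed
  have D1122: "D (m, n) 1 1 2 2" if "m + n + 2 = d" for m n
    using that by (auto simp: D_def unit_idx_def)
  show ?thesis
    unfolding def
  proof (intro conj_cong refl iffI)
    assume pos: ?pos
    {
      assume *: "\<forall>\<alpha> i j k l. fst \<alpha> + snd \<alpha> + 2 = d \<longrightarrow> 1 \<le> i \<longrightarrow> i \<le> j \<longrightarrow> j \<le> k \<longrightarrow> k \<le> l \<longrightarrow>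
          l \<le> 2 \<longrightarrow> D \<alpha> i j k l \<longrightarrow> T \<alpha> i j k l"
      show ?conc
        using *[rule_format, of "(_, _)" 1 1 2 2] T1122[OF _ pos] D1122 by simp
    next
      assume conc: ?conc
      show "\<forall>\<alpha> i j k l. fst \<alpha> + snd \<alpha> + 2 = d \<longrightarrow> 1 \<le> i \<longrightarrow> i \<le> j \<longrightarrow> j \<le> k \<longrightarrow> k \<le> l \<longrightarrow>
          l \<le> 2 \<longrightarrow> D \<alpha> i j k l \<longrightarrow> T \<alpha> i j k l"
      proof (intro allI impI)
        fix \<alpha> and i j k l :: nat
        assume *: "fst \<alpha> + snd \<alpha> + 2 = d" "1 \<le> i" "i \<le> j" "j \<le> k" "k \<le> l" "l \<le> 2"
        show "T \<alpha> i j k l"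
        proof (cases "i = 1 \<and> j = 1 \<and> k = 2 \<and> l = 2")
          case True
          then show ?thesis
            using conc T1122[OF _ pos, of "fst \<alpha>" "snd \<alpha>"] *(1) by simp
        next
          case False
          then show ?thesis
            using T * by blast
        qed
      qed
    }
  qed
qed

section \<open>Comparison\<close>

text \<open>The normalization operator gains the factor \<open>X powr t\<close> in the log-concavity inequality
  at \<open>k = m + 1\<close>, where \<open>X = (k + 1) (d - k + 1) / (k (d - k))\<close>.\<close>

lemma norm_op_rep_poly_mem_L_J:
  assumes \<rho>: "\<rho> \<in> weak_rep d q" and "0 \<le> q" and q: "q \<le> q_bound t d" and "t > 0"
  shows "norm_op t (rep_poly d \<rho>) \<in> L_J d"
proof -
  have pos: "\<rho> \<alpha> > 0" if "\<alpha> \<in> simplex2 d" for \<alpha>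
    using \<rho> that mem_weak_rep_iff[OF \<open>0 \<le> q\<close>] by blast
  have ec: "exp_coeff (norm_op t (rep_poly d \<rho>)) \<alpha> = \<rho> \<alpha> / midx_fact \<alpha> powr t"
    if "\<alpha> \<in> simplex2 d" for \<alpha>
    using that exp_coeff_rep_poly[of d \<rho> \<alpha>] by (simp add: exp_coeff_def lookup_norm_op)
  have "supp2 (norm_op t (rep_poly d \<rho>)) = supp2 (rep_poly d \<rho>)"
    using midx_fact_pos by (auto simp: in_keys_iff lookup_norm_op less_imp_neq[symmetric])
  also have "\<dots> = simplex2 d"
    using pos by (rule supp2_rep_poly)
  finally have supp: "supp2 (norm_op t (rep_poly d \<rho>)) = simplex2 d" .
  have conc: "\<rho> (m + 2, n) / midx_fact (m + 2, n) powr t * (\<rho> (m, n + 2) / midx_fact (m, n + 2) powr t)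
      \<le> (\<rho> (m + 1, n + 1) / midx_fact (m + 1, n + 1) powr t)\<^sup>2" if d: "m + n + 2 = d" for m n
  proof -
    define F X where "F = midx_fact (m + 1, n + 1)"
      and "X = (real m + 2) * (real n + 2) / ((real m + 1) * (real n + 1))"
    have F: "F > 0"
      by (simp add: F_def midx_fact_pos)
    have X: "X > 0"
      by (simp add: X_def)
    have fact_shift: "fact (l + 2) = (real l + 2) * fact (l + 1)"
      "fact l = fact (l + 1) / (real l + 1)" for l
      by (simp_all add: add.commute)
    have FX: "midx_fact (m + 2, n) * midx_fact (m, n + 2) = X * F\<^sup>2"
      unfolding midx_fact_def X_def F_def fst_conv snd_conv
        fact_shift(1) fact_shift(2)[of m] fact_shift(2)[of n]
      by (simp only: power2_eq_square times_divide_times_eq times_divide_eq_left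
          times_divide_eq_right mult_ac divide_divide_eq_left)
    have "q_bound t d \<le> t * log 2 ((real (m + 1) + 1) * (real d - real (m + 1) + 1) /
        (real (m + 1) * (real d - real (m + 1))))"
      unfolding q_bound_def using \<open>t > 0\<close> d
      by (intro mult_left_mono Min_le finite_imageI imageI) auto
    also have "\<dots> = t * log 2 X"
      using d by (auto simp: X_def algebra_simps)
    finally have "2 powr q \<le> 2 powr (t * log 2 X)"
      using q by simp
    also have "\<dots> = X powr t"
      using X by (simp add: powr_powr[symmetric] mult.commute[of t])
    finally have "2 powr q \<le> X powr t" .
    then have "2 powr q * (\<rho> (m + 1, n + 1))\<^sup>2 \<le> X powr t * (\<rho> (m + 1, n + 1))\<^sup>2"
      by (rule mult_right_mono) simp
    moreover have "\<rho> (m + 2, n) * \<rho> (m, n + 2) \<le> 2 powr q * (\<rho> (m + 1, n + 1))\<^sup>2"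
      using \<rho> d unfolding mem_weak_rep_iff[OF \<open>0 \<le> q\<close>] by blast
    ultimately have "\<rho> (m + 2, n) * \<rho> (m, n + 2) \<le> X powr t * (\<rho> (m + 1, n + 1))\<^sup>2"
      by (rule order_trans[rotated])
    then have "\<rho> (m + 2, n) * \<rho> (m, n + 2) / (X powr t * (F powr t)\<^sup>2)
        \<le> X powr t * (\<rho> (m + 1, n + 1))\<^sup>2 / (X powr t * (F powr t)\<^sup>2)"
      by (rule divide_right_mono) simp
    also have "\<dots> = (\<rho> (m + 1, n + 1) / F powr t)\<^sup>2"
      using X by (simp add: power_divide)
    also have "X powr t * (F powr t)\<^sup>2 = midx_fact (m + 2, n) powr t * midx_fact (m, n + 2) powr t"
      unfolding power2_eq_square
      using FX[unfolded power2_eq_square] X F midx_fact_pos[THEN less_imp_le]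
      by (simp only: powr_mult[symmetric])
    finally show ?thesis
      by (simp add: F_def)
  qed
  show ?thesis
    unfolding mem_L_J_iff using supp pos conc midx_fact_pos
    by (auto simp: ec less_imp_neq[symmetric])
qed

lemma R_J_w_not_subset_L_J:
  assumes "d \<ge> 2" and "q > 0"
  shows "\<not> R_J_w d q \<subseteq> L_J d"
proof
  assume sub: "R_J_w d q \<subseteq> L_J d"
  define \<rho> where "\<rho> = restrict (\<lambda>\<alpha>. 2 powr (q * (real (fst \<alpha>))\<^sup>2 / 2)) (simplex2 d)"
  have \<rho>: "\<rho> (m + 2, n) * \<rho> (m, n + 2) = 2 powr q * (\<rho> (m + 1, n + 1))\<^sup>2"
    "\<rho> (m + 1, n + 1) > 0" if "m + n + 2 = d" for m n
  proof -
    have "q * (real (m + 2))\<^sup>2 / 2 + q * (real m)\<^sup>2 / 2 =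
        q + (q * (real (m + 1))\<^sup>2 / 2 + q * (real (m + 1))\<^sup>2 / 2)"
      by (simp add: power2_eq_square algebra_simps add_divide_distrib)
    then show "\<rho> (m + 2, n) * \<rho> (m, n + 2) = 2 powr q * (\<rho> (m + 1, n + 1))\<^sup>2"
      using that by (simp add: \<rho>_def powr_add[symmetric] power2_eq_square[of "_ powr _"])
    show "\<rho> (m + 1, n + 1) > 0"
      using that by (simp add: \<rho>_def)
  qed
  have "\<rho> \<in> weak_rep d q"
    using assms \<rho> by (auto simp: mem_weak_rep_iff) (auto simp: \<rho>_def)
  then have L: "rep_poly d \<rho> \<in> L_J d"
    using sub by (auto simp: R_J_w_def)
  obtain n where n: "0 + n + 2 = d"
    using assms by (metis add.commute add_0 le_Suc_ex)
  have "\<rho> (0 + 2, n) * \<rho> (0, n + 2) \<le> 1 * (\<rho> (0 + 1, n + 1))\<^sup>2"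
    using L n unfolding mem_L_J_iff exp_coeff_rep_poly by (auto split: if_splits)
  moreover have "2 powr q > 1"
    using \<open>q > 0\<close> by simp
  ultimately show False
    unfolding \<rho>(1)[OF n] using \<rho>(2)[OF n] by (simp add: mult_le_cancel_right_pos)
qed

lemma R_J_w_0_eq_L_J: "R_J_w d 0 = L_J d"
proof
  show "R_J_w d 0 \<subseteq> L_J d"
  proof
    fix f assume "f \<in> R_J_w d 0"
    then obtain \<rho> where f: "f = rep_poly d \<rho>" and \<rho>: "\<rho> \<in> weak_rep d 0"
      by (auto simp: R_J_w_def)
    have "supp2 f = simplex2 d"
      unfolding f using \<rho> by (intro supp2_rep_poly) (auto simp: mem_weak_rep_iff)
    then show "f \<in> L_J d"
      using \<rho> by (auto simp: mem_L_J_iff mem_weak_rep_iff f exp_coeff_rep_poly)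
  qed
next
  show "L_J d \<subseteq> R_J_w d 0"
  proof
    fix f assume f: "f \<in> L_J d"
    have "coeff2 (rep_poly d (restrict (exp_coeff f) (simplex2 d))) \<alpha> = coeff2 f \<alpha>" for \<alpha>
      using f midx_fact_pos[of \<alpha>]
      by (auto simp: coeff2_rep_poly exp_coeff_def L_J_def in_keys_iff)
    then have "f = rep_poly d (restrict (exp_coeff f) (simplex2 d))"
      by (intro poly_mapping_eqI) simp
    moreover have "restrict (exp_coeff f) (simplex2 d) \<in> weak_rep d 0"
      using f by (auto simp: mem_L_J_iff mem_weak_rep_iff)
    ultimately show "f \<in> R_J_w d 0"
      unfolding R_J_w_def by (rule image_eqI)
  qed
qed

theorem proposition5p5:
  fixes d :: nat and t :: real
  assumes "d \<ge> 2" and "t > 0"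
  shows "(\<forall>q. 0 < q \<and> q \<le> q_bound t d \<longrightarrow> norm_op t ` R_J_w d q \<subseteq> L_J d) \<and>
    (\<forall>q>0. \<not> norm_op 0 ` R_J_w d q \<subseteq> L_J d \<and> \<not> R_J_w d q \<subseteq> L_J d) \<and>
    R_J_w d 0 = L_J d"
proof (intro conjI allI impI)
  fix q assume "0 < q \<and> q \<le> q_bound t d"
  then show "norm_op t ` R_J_w d q \<subseteq> L_J d"
    using norm_op_rep_poly_mem_L_J[of _ d q t] \<open>t > 0\<close> by (auto simp: R_J_w_def)
next
  fix q :: real assume "q > 0"
  with \<open>d \<ge> 2\<close> show "\<not> R_J_w d q \<subseteq> L_J d"
    by (rule R_J_w_not_subset_L_J)
  then show "\<not> norm_op 0 ` R_J_w d q \<subseteq> L_J d"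
    by (simp add: norm_op_0)
next
  show "R_J_w d 0 = L_J d"
    by (rule R_J_w_0_eq_L_J)
qed

end
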